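(* Let $i\ge2$ be an integer and $\alpha\in(0,\pi/2]$. If $i$ is even, then the rescaled curves $\frac{\sqrt2}{w^{[i]}_{6k+5}}\,\mathcal{F}^{[i]}_{6k+5}$ converge as $k\to\infty$ in the Hausdorff metric on nonempty compact subsets of $\mathbb{R}^2$ (i.e. a scaling limit exists). If $i$ is odd, then the rescaled curves $\frac{\sqrt2}{w^{[i]}_{6k+3}}\,\mathcal{F}^{[i]}_{6k+3}$ converge as $k\to\infty$ in the Hausdorff metric.
   Context: For an integer $i\ge2$, the $i$-Fibonacci words over $\{0,1\}$ are defined by $f^{[i]}_1=0$, $f^{[i]}_2=0^{i-1}1$ (where $0^{i-1}$ denotes $i-1$ zeros), and $f^{[i]}_n=f^{[i]}_{n-1}f^{[i]}_{n-2}$ for $n\ge3$. Drawing rule with drawing angle $\alpha$: given a word $a_1\cdots a_N$, start at the origin with current direction $\theta=\pi/2$. For $j=1,\dots,N$, first draw a unit segment from the current point in direction $\theta$ and move the current point to its endpoint. Then update the direction: if $a_j=0$ and $j$ is even, $\theta\mapsto\theta+\alpha$; if $a_j=0$ and $j$ is odd, $\theta\mapsto\theta-\alpha$; if $a_j=1$, $\theta$ is unchanged. The curve $\mathcal{F}^{[i]}_n\subset\mathbb{R}^2$ is the union of the segments drawn for the word $f^{[i]}_n$; it is a compact set whose first vertex is the origin. $w^{[i]}_n$ denotes the Euclidean distance between the first and last vertices of $\mathcal{F}^{[i]}_n$. For $c>0$ and a set $A$, $cA=\{cx:x\in A\}$ denotes the dilation about the origin. *)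

theory Defs
  imports "HOL-Analysis.Analysis"
begin

text \<open>The plane R^2 is identified with the complex numbers (Euclidean metric).\<close>

text \<open>i-Fibonacci words over {0,1}, 1-indexed in n; the value at n = 0 is an unused dummy.\<close>
fun fibw :: "nat \<Rightarrow> nat \<Rightarrow> nat list" where
  "fibw i 0 = []"
| "fibw i (Suc 0) = [0]"
| "fibw i (Suc (Suc 0)) = replicate (i - 1) 0 @ [1]"
| "fibw i (Suc (Suc (Suc n))) = fibw i (Suc (Suc n)) @ fibw i (Suc n)"

text \<open>Direction change after letter number m (1-based) of the word xs.\<close>
definition turn :: "real \<Rightarrow> nat list \<Rightarrow> nat \<Rightarrow> real" where
  "turn \<alpha> xs m = (if xs ! (m - 1) = 0 then (if even m then \<alpha> else - \<alpha>) else 0)"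

text \<open>Direction used to draw segment number j (1-based).\<close>
definition direction :: "real \<Rightarrow> nat list \<Rightarrow> nat \<Rightarrow> real" where
  "direction \<alpha> xs j = pi / 2 + (\<Sum>m = 1..<j. turn \<alpha> xs m)"

definition vertex :: "real \<Rightarrow> nat list \<Rightarrow> nat \<Rightarrow> complex" where
  "vertex \<alpha> xs j = (\<Sum>m = 1..j. cis (direction \<alpha> xs m))"

definition curve :: "real \<Rightarrow> nat list \<Rightarrow> complex set" where
  "curve \<alpha> xs = (\<Union>j \<in> {1..length xs}. closed_segment (vertex \<alpha> xs (j - 1)) (vertex \<alpha> xs j))"

definition fib_curve :: "nat \<Rightarrow> real \<Rightarrow> nat \<Rightarrow> complex set" where
  "fib_curve i \<alpha> n = curve \<alpha> (fibw i n)"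

definition fib_width :: "nat \<Rightarrow> real \<Rightarrow> nat \<Rightarrow> real" where
  "fib_width i \<alpha> n = dist (vertex \<alpha> (fibw i n) 0) (vertex \<alpha> (fibw i n) (length (fibw i n)))"

definition dilate :: "real \<Rightarrow> complex set \<Rightarrow> complex set" where
  "dilate c A = (\<lambda>x. c *\<^sub>R x) ` A"

text \<open>Hausdorff distance (used for nonempty compact sets).\<close>
definition hausdorff_dist :: "'a::metric_space set \<Rightarrow> 'a set \<Rightarrow> real" where
  "hausdorff_dist A B = max (SUP a\<in>A. infdist a B) (SUP b\<in>B. infdist b A)"

definition hausdorff_converges :: "(nat \<Rightarrow> 'a::metric_space set) \<Rightarrow> bool" where
  "hausdorff_converges S \<longleftrightarrow>
     (\<exists>L. L \<noteq> {} \<and> compact L \<and> (\<lambda>k. hausdorff_dist (S k) L) \<longlonglongrightarrow> 0)"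

end

theory Submission
  imports Defs
begin

text \<open>
  Let \<open>K n\<close> be the curve of the \<open>n\<close>-th word and \<open>D n\<close> its endpoint. The recursion of the words gives
  \<open>K (n + 1) = K n \<union> (D n + U n (K (n - 1)))\<close>, where \<open>U n\<close> is a rotation, composed with a reflection
  if the \<open>n\<close>-th word has odd length. Length parities and total turns have period 6 in \<open>n\<close>, hence so
  has \<open>U\<close>. The endpoints therefore obey a periodic real-linear recursion. Up to rotations and
  conjugations, three of its steps always amount to the same linear map, with eigenvalues \<open>\<mu>\<close>,
  \<open>- 1 / \<mu>\<close>, \<open>1\<close>, \<open>- 1\<close> where \<open>\<mu> - 1 / \<mu> = 2 (1 + cos \<alpha>)\<close>. So \<open>D (n + 6) - \<mu>\<^sup>2 D n\<close> is bounded, and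
  comparing the decompositions of \<open>K (n + 6)\<close> and \<open>\<mu>\<^sup>2 K n\<close> piece by piece bounds their Hausdorff
  distance linearly in \<open>n\<close>. After division by \<open>\<mu>\<close> to the power \<open>2 k\<close> consecutive distances are
  summable along \<open>n = 6 k + r\<close>, and the widths grow exactly like this power because the starting
  vector has a positive \<open>\<mu>\<close>-component.
\<close>

section \<open>Hausdorff convergence\<close>

text \<open>A pointwise bound that composes under chaining, unions and scaling without any supremum;
  it becomes a bound on \<open>hausdorff_dist\<close> only in
  \<open>hausdorff_converges_dilate\<close>.\<close>

definition hausdorff_close :: "real \<Rightarrow> 'a::metric_space set \<Rightarrow> 'a set \<Rightarrow> bool" where
  "hausdorff_close e A B \<longleftrightarrow>
     (\<forall>a\<in>A. \<exists>b\<in>B. dist a b \<le> e) \<and> (\<forall>b\<in>B. \<exists>a\<in>A. dist a b \<le> e)"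

lemma hausdorff_close_mono: "hausdorff_close d A B \<Longrightarrow> d \<le> e \<Longrightarrow> hausdorff_close e A B"
  unfolding hausdorff_close_def by (meson order_trans)

lemma hausdorff_close_refl: "0 \<le> e \<Longrightarrow> hausdorff_close e A A"
  unfolding hausdorff_close_def by (metis dist_self)

lemma hausdorff_close_trans:
  assumes "hausdorff_close d A B" "hausdorff_close e B C"
  shows "hausdorff_close (d + e) A C"
  using assms unfolding hausdorff_close_def by (meson add_mono dist_triangle order_trans)

lemma hausdorff_close_Un:
  "hausdorff_close e A B \<Longrightarrow> hausdorff_close e A' B' \<Longrightarrow> hausdorff_close e (A \<union> A') (B \<union> B')"
  unfolding hausdorff_close_def by blast

lemma hausdorff_close_scaleR:
  fixes A B :: "'a::real_normed_vector set"
  assumes "hausdorff_close e A B"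
  shows "hausdorff_close (\<bar>c\<bar> * e) ((\<lambda>x. c *\<^sub>R x) ` A) ((\<lambda>x. c *\<^sub>R x) ` B)"
proof -
  have "dist (c *\<^sub>R x) (c *\<^sub>R y) \<le> \<bar>c\<bar> * e" if "dist x y \<le> e" for x y :: 'a
    using that by (simp add: dist_norm mult_left_mono flip: scaleR_diff_right)
  then show ?thesis using assms unfolding hausdorff_close_def by fast
qed

lemma hausdorff_close_of_bounded:
  assumes "bounded A" "bounded B" "A \<noteq> {}" "B \<noteq> {}"
  obtains e where "0 \<le> e" "hausdorff_close e A B"
proof -
  have "bounded (A \<union> B)" using assms by simp
  then obtain e where "\<forall>x\<in>A \<union> B. \<forall>y\<in>A \<union> B. dist x y \<le> e"
    using bounded_two_points by metis
  with assms(3,4) that[of e] show thesis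
    unfolding hausdorff_close_def by (metis UnCI all_not_in_conv dist_self)
qed

text \<open>Closeness also bounds the suprema from above, which nonnegativity needs: the supremum of
  an unbounded set of reals is unspecified.\<close>

lemma hausdorff_dist_bounds:
  assumes "hausdorff_close e A B" "A \<noteq> {}" "B \<noteq> {}"
  shows "0 \<le> hausdorff_dist A B" "hausdorff_dist A B \<le> e"
proof -
  have 1: "infdist a B \<le> e" if "a \<in> A" for a
    using that assms(1) unfolding hausdorff_close_def by (meson infdist_le order_trans)
  have 2: "infdist b A \<le> e" if "b \<in> B" for b
    using that assms(1) unfolding hausdorff_close_def by (metis dist_commute infdist_le order_trans)
  show "hausdorff_dist A B \<le> e"
    unfolding hausdorff_dist_def using 1 2 assms by (auto intro!: cSUP_least)
  obtain a where "a \<in> A" using assms by blast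
  have "infdist a B \<le> (SUP a\<in>A. infdist a B)"
    using 1 \<open>a \<in> A\<close> by (intro cSUP_upper bdd_aboveI2[of _ _ e]) auto
  then show "0 \<le> hausdorff_dist A B"
    unfolding hausdorff_dist_def using infdist_nonneg[of a B] by linarith
qed

lemma hausdorff_close_sum:
  fixes A :: "nat \<Rightarrow> 'a::metric_space set"
  assumes "\<And>k. hausdorff_close (e k) (A k) (A (Suc k))"
  shows "hausdorff_close (\<Sum>i<m. e (k + i)) (A k) (A (k + m))"
proof (induction m)
  case 0
  then show ?case by (simp add: hausdorff_close_refl)
next
  case (Suc m)
  show ?case using hausdorff_close_trans[OF Suc assms[of "k + m"]] by simp
qed

text \<open>Completeness of the hyperspace, for sets that need not be closed. The tail sums
  \<open>r k\<close> of the errors bound the distance from \<open>A k\<close> to the limit, and the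
  limit set is defined through these bounds.\<close>

lemma hausdorff_limit_exists:
  fixes A :: "nat \<Rightarrow> 'a::{complete_space,heine_borel} set"
  assumes close: "\<And>k. hausdorff_close (e k) (A k) (A (Suc k))"
    and summable: "summable e" and nonneg: "\<And>k. 0 \<le> e k"
    and A: "\<And>k. A k \<noteq> {}" "\<And>k. bounded (A k)"
  obtains L r where "L \<noteq> {}" "compact L" "r \<longlonglongrightarrow> 0" "\<And>k. hausdorff_close (r k) (A k) L"
proof -
  define r where "r k = (\<Sum>i. e (i + k))" for k
  have sum_le: "(\<Sum>i<m. e (k + i)) + r (k + m) = r k" for k m
  proof -
    have "summable (\<lambda>i. e (i + k))" using summable by (simp add: summable_iff_shift)
    from suminf_split_initial_segment[OF this, of m] show ?thesis
      by (simp add: r_def algebra_simps)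
  qed
  have r_nonneg: "0 \<le> r k" for k
    unfolding r_def using summable nonneg by (intro suminf_nonneg) (auto simp: summable_iff_shift)
  have r_lim: "r \<longlonglongrightarrow> 0"
    unfolding r_def using suminf_exist_split2[OF summable] .
  define L where "L = {y. \<forall>k. infdist y (A k) \<le> r k}"
  \<comment> \<open>Follow a chain of points through \<open>A k\<close>, \<open>A (k + 1)\<close>,
    ... with steps at most \<open>e\<close>; it is Cauchy and its limit serves as \<open>y\<close>.
    The clause for \<open>j = 0\<close> pins the start at \<open>x\<close>, which dependent choice
    would leave free.\<close>
  have near: "\<exists>y\<in>L. dist x y \<le> r k" if x: "x \<in> A k" for x k
  proof -
    have "\<exists>f. \<forall>j. (f j \<in> A (k + j) \<and> (j = 0 \<longrightarrow> f j = x)) \<and> dist (f j) (f (Suc j)) \<le> e (k + j)"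
    proof (rule dependent_nat_choice[where P = "\<lambda>j z. z \<in> A (k + j) \<and> (j = 0 \<longrightarrow> z = x)"
          and Q = "\<lambda>j z y. dist z y \<le> e (k + j)"])
      fix z n assume "z \<in> A (k + n) \<and> (n = 0 \<longrightarrow> z = x)"
      then obtain y where "y \<in> A (Suc (k + n))" "dist z y \<le> e (k + n)"
        using close[of "k + n"] unfolding hausdorff_close_def by blast
      then show "\<exists>y. (y \<in> A (k + Suc n) \<and> (Suc n = 0 \<longrightarrow> y = x)) \<and> dist z y \<le> e (k + n)"
        by auto
    qed (use x in auto)
    then obtain f where f: "\<And>j. f j \<in> A (k + j)" "f 0 = x"
      "\<And>j. dist (f j) (f (Suc j)) \<le> e (k + j)" by blast
    have dist_f: "dist (f j) (f (j + m)) \<le> (\<Sum>i<m. e (k + j + i))" for j m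
    proof (induction m)
      case (Suc m)
      have "dist (f j) (f (j + Suc m)) \<le> dist (f j) (f (j + m)) + dist (f (j + m)) (f (Suc (j + m)))"
        using dist_triangle by simp
      also have "\<dots> \<le> (\<Sum>i<m. e (k + j + i)) + e (k + j + m)"
        using Suc f(3)[of "j + m"] by (simp add: add.assoc)
      finally show ?case by simp
    qed simp
    have dist_r: "dist (f j) (f (j + m)) \<le> r (k + j)" for j m
      using dist_f[of j m] sum_le[of "k + j" m] r_nonneg[of "k + j + m"] by linarith
    have "Cauchy f"
    proof (rule metric_CauchyI)
      fix \<epsilon> :: real assume "0 < \<epsilon>"
      with r_lim have "eventually (\<lambda>n. r n < \<epsilon> / 2) sequentially"
        by (intro order_tendstoD(2)[of r 0]) auto
      then obtain M where M: "\<And>n. n \<ge> M \<Longrightarrow> r n < \<epsilon> / 2"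
        unfolding eventually_sequentially by blast
      have "dist (f M) (f m) < \<epsilon> / 2" if "m \<ge> M" for m
        using dist_r[of M "m - M"] M[of "k + M"] that by simp
      then have "dist (f m) (f n) < \<epsilon>" if "m \<ge> M" "n \<ge> M" for m n
        using that dist_triangle_half_r by blast
      then show "\<exists>M. \<forall>m\<ge>M. \<forall>n\<ge>M. dist (f m) (f n) < \<epsilon>" by blast
    qed
    then obtain y where y: "f \<longlonglongrightarrow> y" using Cauchy_convergent convergent_def by blast
    have dist_y: "dist (f j) y \<le> r (k + j)" for j
    proof (rule tendsto_upperbound)
      show "(\<lambda>m. dist (f j) (f (m + j))) \<longlonglongrightarrow> dist (f j) y"
        using LIMSEQ_ignore_initial_segment[OF y] by (intro tendsto_intros)
      show "\<forall>\<^sub>F m in sequentially. dist (f j) (f (m + j)) \<le> r (k + j)"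
        using dist_r[of j] by (simp add: add.commute)
    qed simp
    have "infdist y (A j) \<le> r j" for j
    proof (cases "k \<le> j")
      case True
      then have "f (j - k) \<in> A j" "dist (f (j - k)) y \<le> r j"
        using f(1)[of "j - k"] dist_y[of "j - k"] by auto
      then show ?thesis by (metis dist_commute infdist_le order_trans)
    next
      \<comment> \<open>The chain never visits the sets before \<open>A k\<close>, so go back from
        \<open>x\<close> to some \<open>z\<close> in \<open>A j\<close> at cost e j + ... + e (k -
        1). Adding the tail \<open>r k\<close> gives exactly \<open>r j\<close>.\<close>
      case False
      obtain z where z: "z \<in> A j" "dist z x \<le> (\<Sum>i<k - j. e (j + i))"
        using hausdorff_close_sum[of e A j "k - j", OF close] x False
        unfolding hausdorff_close_def by auto
      have "infdist y (A j) \<le> dist y z" using z by (simp add: infdist_le)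
      also have "\<dots> \<le> dist z x + dist x y" by (metis dist_commute dist_triangle)
      also have "\<dots> \<le> (\<Sum>i<k - j. e (j + i)) + r (j + (k - j))"
        using z(2) dist_y[of 0] f(2) False by simp
      finally show ?thesis by (simp add: sum_le)
    qed
    then show ?thesis using dist_y[of 0] f(2) by (auto simp: L_def)
  qed
  \<comment> \<open>As \<open>A k\<close> need not be closed, the infimum in \<open>infdist\<close>
    may not be attained; the slack yields an actual point and still tends to 0.\<close>
  have L_near: "\<exists>x\<in>A k. dist x y \<le> r k + 1 / real (Suc k)" if "y \<in> L" for y k
  proof -
    have "infdist y (A k) < r k + 1 / real (Suc k)"
      using that by (simp add: L_def add_pos_nonneg order_le_less_trans[of _ "r k"])
    then have "(INF x\<in>A k. dist y x) < r k + 1 / real (Suc k)"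
      using A(1)[of k] by (simp add: infdist_notempty)
    then obtain x where "x \<in> A k" "dist y x < r k + 1 / real (Suc k)"
      using A(1)[of k] cInf_lessD[of "dist y ` A k"] by auto
    then show ?thesis by (metis dist_commute less_imp_le)
  qed
  show thesis
  proof
    show "L \<noteq> {}" using near A(1)[of 0] by blast
    have "closed L"
      unfolding L_def by (intro closed_Collect_all closed_Collect_le continuous_intros)
    moreover have "bounded L"
    proof -
      obtain z M where M: "\<And>x. x \<in> A 0 \<Longrightarrow> dist z x \<le> M"
        using A(2)[of 0] unfolding bounded_def by blast
      have "dist z y \<le> M + (r 0 + 1)" if "y \<in> L" for y
      proof -
        obtain x where "x \<in> A 0" "dist x y \<le> r 0 + 1" using L_near[OF \<open>y \<in> L\<close>, of 0] by auto
        then show ?thesis using M[of x] dist_triangle[of z y x] by linarith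
      qed
      then show ?thesis unfolding bounded_def by blast
    qed
    ultimately show "compact L" using compact_eq_bounded_closed by blast
    show "(\<lambda>k. r k + 1 / real (Suc k)) \<longlonglongrightarrow> 0"
      using tendsto_add[OF r_lim lim_inverse_n'[THEN LIMSEQ_Suc]] by simp
    show "hausdorff_close (r k + 1 / real (Suc k)) (A k) L" for k
    proof -
      have "r k \<le> r k + 1 / real (Suc k)" by simp
      then have "\<exists>y\<in>L. dist x y \<le> r k + 1 / real (Suc k)" if "x \<in> A k" for x
        using near[OF that] order_trans by blast
      then show ?thesis
        unfolding hausdorff_close_def using L_near[of _ k] by blast
    qed
  qed
qed

text \<open>Allows a change of normalisation: curves rescaled by exact powers converge first, and
  the passage to the widths is absorbed in \<open>s\<close>. The error splits as s k (a - y) + (s k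
  - t) y with y bounded on \<open>L\<close>.\<close>

lemma hausdorff_converges_dilate:
  fixes A :: "nat \<Rightarrow> complex set"
  assumes L: "L \<noteq> {}" "compact L" and r: "r \<longlonglongrightarrow> 0"
    and close: "\<And>k. hausdorff_close (r k) (A k) L" and A: "\<And>k. A k \<noteq> {}"
    and s: "s \<longlonglongrightarrow> t"
  shows "hausdorff_converges (\<lambda>k. dilate (s k) (A k))"
  unfolding hausdorff_converges_def
proof (intro exI[of _ "dilate t L"] conjI)
  show "dilate t L \<noteq> {}" "compact (dilate t L)"
    using L by (auto simp: dilate_def compact_scaling)
  obtain R where R: "\<And>y. y \<in> L \<Longrightarrow> norm y \<le> R"
    using compact_imp_bounded[OF L(2)] unfolding bounded_iff by blast
  have scaled: "hausdorff_close (\<bar>s k - t\<bar> * R + \<bar>s k\<bar> * r k) (dilate (s k) (A k)) (dilate t L)" for k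
  proof -
    have "hausdorff_close (\<bar>s k - t\<bar> * R) (dilate (s k) L) (dilate t L)"
    proof -
      have "dist (s k *\<^sub>R y) (t *\<^sub>R y) \<le> \<bar>s k - t\<bar> * R" if "y \<in> L" for y
        using R[OF that] by (simp add: dist_norm mult_left_mono flip: scaleR_diff_left)
      then show ?thesis unfolding hausdorff_close_def dilate_def by blast
    qed
    from hausdorff_close_trans[OF hausdorff_close_scaleR[OF close[of k], of "s k"] this[unfolded dilate_def]]
    show ?thesis by (simp add: dilate_def add.commute)
  qed
  have ne: "dilate (s k) (A k) \<noteq> {}" "dilate t L \<noteq> {}" for k
    using A L by (auto simp: dilate_def)
  show "(\<lambda>k. hausdorff_dist (dilate (s k) (A k)) (dilate t L)) \<longlonglongrightarrow> 0"
  proof (rule tendsto_sandwich[where f = "\<lambda>_. 0" and h = "\<lambda>k. \<bar>s k - t\<bar> * R + \<bar>s k\<bar> * r k"])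
    have "(\<lambda>k. \<bar>s k - t\<bar> * R + \<bar>s k\<bar> * r k) \<longlonglongrightarrow> \<bar>t - t\<bar> * R + \<bar>t\<bar> * 0"
      by (intro tendsto_intros s r)
    then show "(\<lambda>k. \<bar>s k - t\<bar> * R + \<bar>s k\<bar> * r k) \<longlonglongrightarrow> 0" by simp
    show "\<forall>\<^sub>F k in sequentially. 0 \<le> hausdorff_dist (dilate (s k) (A k)) (dilate t L)"
      using hausdorff_dist_bounds(1)[OF scaled ne] by simp
    show "\<forall>\<^sub>F k in sequentially. hausdorff_dist (dilate (s k) (A k)) (dilate t L)
        \<le> \<bar>s k - t\<bar> * R + \<bar>s k\<bar> * r k"
      using hausdorff_dist_bounds(2)[OF scaled ne] by simp
  qed simp
qed

section \<open>Self-similar sequences of curves\<close>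

text \<open>The inequality at most doubles a bound per index, and the bounds on two consecutive
  residues are renewed every six indices; hence the factor 64. A finite sum covers the indices below
  \<open>j\<close>.\<close>

lemma bounded_from_two_residues:
  fixes h :: "nat \<Rightarrow> 'a::real_normed_vector"
  assumes step: "\<And>n. norm (h (Suc (Suc n))) \<le> norm (h (Suc n)) + norm (h n)"
    and B: "\<And>k. norm (h (6 * k + j)) \<le> B" "\<And>k. norm (h (6 * k + Suc j)) \<le> B"
  obtains B' where "\<And>n. norm (h n) \<le> B'"
proof -
  have "0 \<le> B" using B(1)[of 0] norm_ge_zero order_trans by blast
  have pow: "norm (h (6 * k + j + q)) \<le> 2 ^ q * B \<and> norm (h (6 * k + j + Suc q)) \<le> 2 ^ Suc q * B" for k q
  proof (induction q)
    case 0
    then show ?case using B(1)[of k] B(2)[of k] \<open>0 \<le> B\<close> by simp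
  next
    case (Suc q)
    have "norm (h (6 * k + j + Suc (Suc q))) \<le> 2 ^ Suc q * B + 2 ^ q * B"
      using step[of "6 * k + j + q"] Suc by (simp del: power_Suc)
    also have "\<dots> \<le> 2 ^ Suc (Suc q) * B" using \<open>0 \<le> B\<close> by (simp add: mult_right_mono)
    finally show ?case using Suc by blast
  qed
  have "norm (h n) \<le> (\<Sum>m<j. norm (h m)) + 64 * B" for n
  proof (cases "n < j")
    case True
    then have "norm (h n) \<le> (\<Sum>m<j. norm (h m))" by (intro member_le_sum) auto
    then show ?thesis using \<open>0 \<le> B\<close> by simp
  next
    case False
    define q where "q = (n - j) mod 6"
    have "n = 6 * ((n - j) div 6) + j + q" using False by (simp add: q_def)
    then have "norm (h n) \<le> 2 ^ q * B" using pow by metis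
    also have "\<dots> \<le> 2 ^ 6 * B"
      using \<open>0 \<le> B\<close> by (intro mult_right_mono power_increasing) (simp_all add: q_def less_imp_le)
    finally show ?thesis by (simp add: sum_nonneg add_increasing)
  qed
  then show thesis by (rule that)
qed

text \<open>Induction on two consecutive indices. A union costs only the larger error of its parts,
  and a moved part gains at most \<open>B\<close>, so the error rises by at most \<open>B\<close>
  per index.\<close>

lemma hausdorff_close_scaled_curves:
  fixes K :: "nat \<Rightarrow> complex set" and c :: real
  assumes K: "\<And>n. K (Suc (Suc n)) = K (Suc n) \<union> (\<lambda>z. D (Suc n) + U (Suc n) z) ` K n"
    and linear: "\<And>n. linear (U n)" and norm: "\<And>n z. norm (U n z) = norm z"
    and periodic: "\<And>n. U (n + 6) = U n"
    and D: "\<And>n. norm (D (n + 6) - c *\<^sub>R D n) \<le> B"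
    and bounded: "\<And>n. bounded (K n)" and nonempty: "\<And>n. K n \<noteq> {}"
  obtains C where "0 \<le> C"
    "\<And>n. hausdorff_close (C + B * real n) ((\<lambda>z. c *\<^sub>R z) ` K n) (K (n + 6))"
proof -
  have "0 \<le> B" using D[of 0] norm_ge_zero order_trans by blast
  have base: "\<exists>e\<ge>0. hausdorff_close e ((\<lambda>z. c *\<^sub>R z) ` K n) (K (n + 6))" for n
    using hausdorff_close_of_bounded[of "(\<lambda>z. c *\<^sub>R z) ` K n" "K (n + 6)"]
      bounded nonempty bounded_scaling by (metis image_is_empty)
  obtain C0 C1 where C: "0 \<le> C0" "0 \<le> C1"
      "hausdorff_close C0 ((\<lambda>z. c *\<^sub>R z) ` K 0) (K (0 + 6))"
      "hausdorff_close C1 ((\<lambda>z. c *\<^sub>R z) ` K 1) (K (1 + 6))"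
    using base by metis
  let ?C = "max C0 C1"
  \<comment> \<open>By periodicity both pieces are moved by the same linear isometry. It commutes
    with scaling and preserves \<open>e\<close>, which leaves the mismatch \<open>B\<close> of the
    translations.\<close>
  have step: "hausdorff_close (B + e) ((\<lambda>z. c *\<^sub>R z) ` (\<lambda>z. D m + U m z) ` P)
      ((\<lambda>z. D (m + 6) + U (m + 6) z) ` Q)"
    if "hausdorff_close e ((\<lambda>z. c *\<^sub>R z) ` P) Q" for e m P Q
  proof -
    have "dist (c *\<^sub>R (D m + U m y)) (D (m + 6) + U (m + 6) z) \<le> B + e"
      if "dist (c *\<^sub>R y) z \<le> e" for y z
    proof -
      have "c *\<^sub>R (D m + U m y) - (D (m + 6) + U (m + 6) z) =
          - (D (m + 6) - c *\<^sub>R D m) + U m (c *\<^sub>R y - z)"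
        by (simp add: periodic linear_diff[OF linear] linear_cmul[OF linear] algebra_simps)
      then have "dist (c *\<^sub>R (D m + U m y)) (D (m + 6) + U (m + 6) z) \<le>
          norm (- (D (m + 6) - c *\<^sub>R D m)) + norm (U m (c *\<^sub>R y - z))"
        by (metis dist_norm norm_triangle_ineq)
      also have "\<dots> \<le> B + e"
        using D[of m] that by (simp only: norm norm_minus_cancel dist_norm add_mono)
      finally show ?thesis .
    qed
    with that show ?thesis unfolding hausdorff_close_def by fast
  qed
  have "hausdorff_close (?C + B * real n) ((\<lambda>z. c *\<^sub>R z) ` K n) (K (n + 6)) \<and>
      hausdorff_close (?C + B * real (Suc n)) ((\<lambda>z. c *\<^sub>R z) ` K (Suc n)) (K (Suc n + 6))" for n
  proof (induction n)
    case 0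
    show ?case
      using hausdorff_close_mono[OF C(3), of ?C] hausdorff_close_mono[OF C(4), of "?C + B"] \<open>0 \<le> B\<close>
      by simp
  next
    case (Suc n)
    have "hausdorff_close (?C + B * real (Suc (Suc n)))
        ((\<lambda>z. c *\<^sub>R z) ` K (Suc n) \<union> (\<lambda>z. c *\<^sub>R z) ` (\<lambda>z. D (Suc n) + U (Suc n) z) ` K n)
        (K (Suc n + 6) \<union> (\<lambda>z. D (Suc n + 6) + U (Suc n + 6) z) ` K (n + 6))"
    proof (rule hausdorff_close_Un)
      show "hausdorff_close (?C + B * real (Suc (Suc n))) ((\<lambda>z. c *\<^sub>R z) ` K (Suc n)) (K (Suc n + 6))"
        using Suc \<open>0 \<le> B\<close> by (elim conjE, elim hausdorff_close_mono) (simp add: algebra_simps)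
      show "hausdorff_close (?C + B * real (Suc (Suc n)))
          ((\<lambda>z. c *\<^sub>R z) ` (\<lambda>z. D (Suc n) + U (Suc n) z) ` K n)
          ((\<lambda>z. D (Suc n + 6) + U (Suc n + 6) z) ` K (n + 6))"
        using \<open>0 \<le> B\<close>
        by (intro hausdorff_close_mono[OF step[OF Suc[THEN conjunct1]]]) (simp add: algebra_simps)
    qed
    moreover have "K (Suc (Suc n) + 6) =
        K (Suc n + 6) \<union> (\<lambda>z. D (Suc n + 6) + U (Suc n + 6) z) ` K (n + 6)"
      using K[of "n + 6"] by simp
    ultimately show ?case
      using Suc unfolding K[of n] image_Un by simp
  qed
  with C that[of ?C] show thesis by auto
qed

text \<open>Asymptotics along two consecutive residues suffice: together they control all endpoints
  through the second-order recursion, and the residue \<open>Suc j\<close> also gives the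
  widths.\<close>

lemma scaling_limit_of_self_similar_curves:
  fixes K :: "nat \<Rightarrow> complex set" and c :: real
  assumes K: "\<And>n. K (Suc (Suc n)) = K (Suc n) \<union> (\<lambda>z. D (Suc n) + U (Suc n) z) ` K n"
    and D: "\<And>n. D (Suc (Suc n)) = D (Suc n) + U (Suc n) (D n)"
    and linear: "\<And>n. linear (U n)" and norm: "\<And>n z. norm (U n z) = norm z"
    and periodic: "\<And>n. U (n + 6) = U n"
    and bounded: "\<And>n. bounded (K n)" and nonempty: "\<And>n. K n \<noteq> {}"
    and c: "1 < c" and a: "a \<noteq> 0"
    and asymp: "\<And>k. norm (D (6 * k + Suc j) - a * of_real (c ^ k)) \<le> B"
      "\<And>k. norm (D (6 * k + j) - b * of_real (c ^ k)) \<le> B"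
  shows "hausdorff_converges
    (\<lambda>k. dilate (sqrt 2 / norm (D (6 * k + Suc j))) (K (6 * k + Suc j)))"
proof -
  \<comment> \<open>\<open>h\<close> obeys the recursion of \<open>D\<close>, and on the two given
    residues the leading terms cancel, leaving at most B + c B.\<close>
  define h where "h n = D (n + 6) - c *\<^sub>R D n" for n
  have h_Suc: "h (Suc (Suc n)) = h (Suc n) + U (Suc n) (h n)" for n
  proof -
    have "D (Suc (Suc n) + 6) = D (Suc n + 6) + U (Suc n) (D (n + 6))"
      using D[of "n + 6"] periodic[of "Suc n"] by simp
    then show ?thesis
      unfolding h_def D[of n] linear_diff[OF linear] linear_cmul[OF linear]
      by (simp add: scaleR_add_right)
  qed
  have "norm (h (Suc (Suc n))) \<le> norm (h (Suc n)) + norm (h n)" for n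
    unfolding h_Suc using norm_triangle_ineq[of "h (Suc n)" "U (Suc n) (h n)"] by (simp add: norm)
  moreover have residue: "norm (h (6 * k + i)) \<le> (1 + c) * B"
    if "\<And>k. norm (D (6 * k + i) - w * of_real (c ^ k)) \<le> B" for k i w
  proof -
    have "6 * k + i + 6 = 6 * Suc k + i" by simp
    then have "h (6 * k + i) = (D (6 * Suc k + i) - w * of_real (c ^ Suc k)) -
        c *\<^sub>R (D (6 * k + i) - w * of_real (c ^ k))"
      unfolding h_def by (simp add: scaleR_conv_of_real algebra_simps)
    also have "norm \<dots> \<le> norm (D (6 * Suc k + i) - w * of_real (c ^ Suc k)) +
        norm (c *\<^sub>R (D (6 * k + i) - w * of_real (c ^ k)))"
      by (rule norm_triangle_ineq4)
    also have "\<dots> \<le> B + c * B"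
      using that[of "Suc k"] that[of k] c by (intro add_mono) (auto simp: mult_left_mono)
    finally show ?thesis by (simp add: algebra_simps)
  qed
  ultimately obtain B' where B': "\<And>n. norm (h n) \<le> B'"
    using bounded_from_two_residues[of h j "(1 + c) * B"] residue[OF asymp(2)] residue[OF asymp(1)]
    by blast
  then have "0 \<le> B'" using norm_ge_zero order_trans by blast
  obtain C where C: "0 \<le> C"
      "\<And>n. hausdorff_close (C + B' * real n) ((\<lambda>z. c *\<^sub>R z) ` K n) (K (n + 6))"
    using hausdorff_close_scaled_curves[of K D U c B', OF K linear norm periodic B'[unfolded h_def] bounded nonempty]
    by blast
  define A where "A k = (\<lambda>z. (1 / c ^ k) *\<^sub>R z) ` K (6 * k + Suc j)" for k
  \<comment> \<open>Dividing the linear error by \<open>c ^ Suc k\<close> leaves at most a constant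
    times (k + 1) / c^k, the terms of a differentiated geometric series.\<close>
  define e where "e k = (C + B' * real (Suc j) + 6 * B') * (real (Suc k) * (1 / c) ^ k)" for k
  have e_nonneg: "0 \<le> e k" for k
    unfolding e_def using C(1) \<open>0 \<le> B'\<close> c by (intro mult_nonneg_nonneg add_nonneg_nonneg) auto
  have close: "hausdorff_close (e k) (A k) (A (Suc k))" for k
  proof -
    let ?n = "6 * k + Suc j"
    have "hausdorff_close (\<bar>1 / c ^ Suc k\<bar> * (C + B' * real ?n))
        ((\<lambda>z. (1 / c ^ Suc k) *\<^sub>R z) ` (\<lambda>z. c *\<^sub>R z) ` K ?n)
        ((\<lambda>z. (1 / c ^ Suc k) *\<^sub>R z) ` K (?n + 6))"
      by (rule hausdorff_close_scaleR[OF C(2)])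
    moreover have "(\<lambda>z. (1 / c ^ Suc k) *\<^sub>R z) ` (\<lambda>z. c *\<^sub>R z) ` K ?n = A k"
      unfolding A_def image_image using c by (simp add: field_simps)
    moreover have "(\<lambda>z. (1 / c ^ Suc k) *\<^sub>R z) ` K (?n + 6) = A (Suc k)"
      unfolding A_def by (simp add: algebra_simps)
    ultimately have "hausdorff_close (\<bar>1 / c ^ Suc k\<bar> * (C + B' * real ?n)) (A k) (A (Suc k))"
      by simp
    then show ?thesis
    proof (rule hausdorff_close_mono)
      have "C + B' * real ?n \<le> (C + B' * real (Suc j) + 6 * B') * real (Suc k)"
        using C(1) \<open>0 \<le> B'\<close> by (simp add: algebra_simps)
      moreover have "\<bar>1 / c ^ Suc k\<bar> \<le> (1 / c) ^ k"
        using c by (simp add: power_one_over field_simps)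
      ultimately have "\<bar>1 / c ^ Suc k\<bar> * (C + B' * real ?n) \<le>
          (1 / c) ^ k * ((C + B' * real (Suc j) + 6 * B') * real (Suc k))"
        using C(1) \<open>0 \<le> B'\<close> c by (intro mult_mono) auto
      then show "\<bar>1 / c ^ Suc k\<bar> * (C + B' * real ?n) \<le> e k"
        by (simp add: e_def mult_ac)
    qed
  qed
  have "summable e"
    unfolding e_def using geometric_deriv_sums[of "1 / c"] c
    by (intro summable_mult) (auto simp: sums_iff)
  have A: "A k \<noteq> {}" "bounded (A k)" for k
    using nonempty bounded_scaling[OF bounded] by (auto simp: A_def)
  obtain L r where L: "L \<noteq> {}" "compact L" "r \<longlonglongrightarrow> 0" "\<And>k. hausdorff_close (r k) (A k) L"
    using hausdorff_limit_exists[of e A, OF close \<open>summable e\<close> e_nonneg A] by blast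
  \<comment> \<open>The remaining factor between the two normalisations. It converges because the
    width divided by c^k tends to \<open>norm a\<close>, which is nonzero.\<close>
  define s where "s k = sqrt 2 / (norm (D (6 * k + Suc j)) / c ^ k)" for k
  have "(\<lambda>k. D (6 * k + Suc j) / of_real (c ^ k)) \<longlonglongrightarrow> a"
  proof (rule LIM_zero_cancel)
    show "(\<lambda>k. D (6 * k + Suc j) / of_real (c ^ k) - a) \<longlonglongrightarrow> 0"
    proof (rule Lim_null_comparison)
      show "\<forall>\<^sub>F k in sequentially. norm (D (6 * k + Suc j) / of_real (c ^ k) - a) \<le> B * (1 / c) ^ k"
      proof (intro always_eventually allI)
        fix k
        have "D (6 * k + Suc j) / of_real (c ^ k) - a =
            (D (6 * k + Suc j) - a * of_real (c ^ k)) / of_real (c ^ k)"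
          using c by (simp add: field_simps)
        then have "norm (D (6 * k + Suc j) / of_real (c ^ k) - a) =
            norm (D (6 * k + Suc j) - a * of_real (c ^ k)) / c ^ k"
          using c by (simp add: norm_divide norm_power)
        also have "\<dots> \<le> B / c ^ k" using asymp(1)[of k] c by (intro divide_right_mono) auto
        finally show "norm (D (6 * k + Suc j) / of_real (c ^ k) - a) \<le> B * (1 / c) ^ k"
          by (simp add: power_one_over)
      qed
      show "(\<lambda>k. B * (1 / c) ^ k) \<longlonglongrightarrow> 0"
        using c by (intro tendsto_mult_right_zero LIMSEQ_realpow_zero) auto
    qed
  qed
  then have "(\<lambda>k. norm (D (6 * k + Suc j) / of_real (c ^ k))) \<longlonglongrightarrow> norm a"
    by (rule tendsto_norm)
  then have "(\<lambda>k. norm (D (6 * k + Suc j)) / c ^ k) \<longlonglongrightarrow> norm a"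
    using c by (simp add: norm_divide norm_power)
  then have "s \<longlonglongrightarrow> sqrt 2 / norm a"
    unfolding s_def using a by (intro tendsto_intros) auto
  from hausdorff_converges_dilate[OF L A(1) this]
  have "hausdorff_converges (\<lambda>k. dilate (s k) (A k))" .
  moreover have "dilate (s k) (A k) = dilate (sqrt 2 / norm (D (6 * k + Suc j))) (K (6 * k + Suc j))" for k
    unfolding dilate_def A_def image_image s_def using c by simp
  ultimately show ?thesis by simp
qed

section \<open>Curves of concatenated words\<close>

text \<open>The turn after the last letter is included: no segment of \<open>xs\<close> shows it,
  but the first segment of an appended word does.\<close>

definition total_turn :: "real \<Rightarrow> nat list \<Rightarrow> real" where
  "total_turn \<alpha> xs = (\<Sum>m = 1..length xs. turn \<alpha> xs m)"

definition last_vertex :: "real \<Rightarrow> nat list \<Rightarrow> complex" where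
  "last_vertex \<alpha> xs = vertex \<alpha> xs (length xs)"

text \<open>The isometry carrying the curve of a word \<open>v\<close>, up to translation, onto its copy inside the
  curve of \<open>u @ v\<close>. When \<open>u\<close> has odd length the parities of the positions in \<open>v\<close> change, which
  reflects the curve in its initial direction, the vertical axis.\<close>
definition placement :: "real \<Rightarrow> nat list \<Rightarrow> complex \<Rightarrow> complex" where
  "placement \<alpha> u z = cis (total_turn \<alpha> u) * (if even (length u) then z else - cnj z)"

lemma linear_placement: "linear (placement \<alpha> u)"
  by (rule linearI) (auto simp: placement_def algebra_simps scaleR_conv_of_real)

lemma norm_placement: "norm (placement \<alpha> u z) = norm z"
  by (simp add: placement_def norm_mult)

lemma turn_append_left: "1 \<le> m \<Longrightarrow> m \<le> length u \<Longrightarrow> turn \<alpha> (u @ v) m = turn \<alpha> u m"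
  by (auto simp: turn_def nth_append)

lemma turn_append_right:
  "1 \<le> m \<Longrightarrow> turn \<alpha> (u @ v) (m + length u) = (if even (length u) then 1 else - 1) * turn \<alpha> v m"
  by (auto simp: turn_def nth_append)

lemma sum_turn_append:
  "(\<Sum>m = 1..<j + length u. turn \<alpha> (u @ v) m) =
     total_turn \<alpha> u + (if even (length u) then 1 else - 1) * (\<Sum>m = 1..<j. turn \<alpha> v m)"
  if "1 \<le> j" for j
proof -
  have "(\<Sum>m = 1..<j + length u. turn \<alpha> (u @ v) m) =
      (\<Sum>m = 1..<1 + length u. turn \<alpha> (u @ v) m) +
      (\<Sum>m = 1 + length u..<j + length u. turn \<alpha> (u @ v) m)"
    using that by (subst sum.atLeastLessThan_concat) auto
  also have "(\<Sum>m = 1..<1 + length u. turn \<alpha> (u @ v) m) = total_turn \<alpha> u"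
    unfolding total_turn_def by (rule sum.cong) (auto simp: turn_append_left)
  also have "(\<Sum>m = 1 + length u..<j + length u. turn \<alpha> (u @ v) m) =
      (\<Sum>m = 1..<j. turn \<alpha> (u @ v) (m + length u))"
    by (rule sum.shift_bounds_nat_ivl)
  also have "\<dots> = (\<Sum>m = 1..<j. (if even (length u) then 1 else - 1) * turn \<alpha> v m)"
    by (rule sum.cong[OF refl], rule turn_append_right) simp
  finally show ?thesis by (simp add: sum_distrib_left)
qed

lemma total_turn_append:
  "total_turn \<alpha> (u @ v) =
     total_turn \<alpha> u + (if even (length u) then 1 else - 1) * total_turn \<alpha> v"
  using sum_turn_append[of "Suc (length v)" \<alpha> u v]
  by (simp add: total_turn_def atLeastLessThanSuc_atLeastAtMost add.commute)

lemma direction_append_left: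
  assumes "j \<le> length u" shows "direction \<alpha> (u @ v) j = direction \<alpha> u j"
proof -
  have "(\<Sum>m = 1..<j. turn \<alpha> (u @ v) m) = (\<Sum>m = 1..<j. turn \<alpha> u m)"
    using assms by (intro sum.cong[OF refl] turn_append_left) auto
  then show ?thesis by (simp add: direction_def)
qed

text \<open>After a prefix of odd length all turns of \<open>v\<close> change sign, and
  \<open>- cnj\<close> does just this: it maps cis (pi / 2 + t) to cis (pi / 2 - t).\<close>

lemma cis_direction_append_right:
  assumes "1 \<le> j"
  shows "cis (direction \<alpha> (u @ v) (j + length u)) = placement \<alpha> u (cis (direction \<alpha> v j))"
proof (cases "even (length u)")
  case True
  then show ?thesis
    unfolding direction_def sum_turn_append[OF assms] placement_def
    by (simp add: cis_mult algebra_simps)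
next
  case False
  then show ?thesis
    unfolding direction_def sum_turn_append[OF assms] placement_def
    by (simp add: cis_cnj cis_mult) (simp add: cis.ctr complex_eq_iff algebra_simps cos_add sin_add cos_diff sin_diff)
qed

lemma vertex_append_left:
  assumes "j \<le> length u" shows "vertex \<alpha> (u @ v) j = vertex \<alpha> u j"
  unfolding vertex_def
  using assms by (intro sum.cong[OF refl]) (simp add: direction_append_left)

lemma vertex_append_right:
  "vertex \<alpha> (u @ v) (j + length u) = last_vertex \<alpha> u + placement \<alpha> u (vertex \<alpha> v j)"
proof (induction j)
  case 0
  then show ?case
    using linear_0[OF linear_placement, of \<alpha> u]
    by (simp add: vertex_append_left last_vertex_def vertex_def[of _ v])
next
  case (Suc j)
  have "vertex \<alpha> (u @ v) (Suc j + length u) =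
      vertex \<alpha> (u @ v) (j + length u) + cis (direction \<alpha> (u @ v) (Suc j + length u))"
    by (simp add: vertex_def)
  also have "\<dots> = last_vertex \<alpha> u + placement \<alpha> u (vertex \<alpha> v j) +
      placement \<alpha> u (cis (direction \<alpha> v (Suc j)))"
    by (simp add: Suc cis_direction_append_right del: add_Suc)
  also have "\<dots> = last_vertex \<alpha> u + placement \<alpha> u (vertex \<alpha> v (Suc j))"
    by (simp add: vertex_def linear_add[OF linear_placement])
  finally show ?case .
qed

lemma last_vertex_append:
  "last_vertex \<alpha> (u @ v) = last_vertex \<alpha> u + placement \<alpha> u (last_vertex \<alpha> v)"
  using vertex_append_right[of \<alpha> u v "length v"] by (simp add: last_vertex_def add.commute)

lemma curve_append:
  "curve \<alpha> (u @ v) = curve \<alpha> u \<union> (\<lambda>z. last_vertex \<alpha> u + placement \<alpha> u z) ` curve \<alpha> v"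
proof -
  let ?seg = "\<lambda>w j. closed_segment (vertex \<alpha> w (j - 1)) (vertex \<alpha> w j)"
  have seg_left: "?seg (u @ v) j = ?seg u j" if "j \<in> {1..length u}" for j
    using that vertex_append_left[of "j - 1" u] vertex_append_left[of j u] by auto
  have seg_right: "?seg (u @ v) (j + length u) =
      (\<lambda>z. last_vertex \<alpha> u + placement \<alpha> u z) ` ?seg v j" if "j \<in> {1..length v}" for j
  proof -
    have j: "j + length u - 1 = (j - 1) + length u" using that by simp
    have "(\<lambda>z. last_vertex \<alpha> u + placement \<alpha> u z) ` ?seg v j =
        (+) (last_vertex \<alpha> u) ` placement \<alpha> u ` ?seg v j"
      by (simp add: image_image)
    also have "\<dots> = ?seg (u @ v) (j + length u)"
      unfolding j vertex_append_right closed_segment_linear_image[OF linear_placement, symmetric]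
      by (rule closed_segment_translation[symmetric])
    finally show ?thesis ..
  qed
  have split: "{1..length (u @ v)} = {1..length u} \<union> (\<lambda>j. j + length u) ` {1..length v}"
    by (auto simp: image_add_atLeastAtMost')
  show ?thesis
    unfolding curve_def split UN_Un image_UN image_image
    by (rule arg_cong2[where f = "(\<union>)"]; rule SUP_cong[OF refl]; (erule seg_left | erule seg_right))
qed

lemma bounded_curve: "bounded (curve \<alpha> xs)"
  unfolding curve_def by (intro bounded_UN ballI bounded_closed_segment finite_atLeastAtMost)

lemma curve_nonempty: "xs \<noteq> [] \<Longrightarrow> curve \<alpha> xs \<noteq> {}"
  unfolding curve_def by (auto simp: Suc_le_eq)

text \<open>Along a run of zeros the turns alternate, starting with - \<alpha>. For positive
  \<open>m\<close> there are m - 1 of them, so they cancel unless \<open>m\<close> is even.\<close>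

lemma sum_turn_replicate:
  "m \<le> Suc n \<Longrightarrow> (\<Sum>j = 1..<m. turn \<alpha> (replicate n 0 @ ys) j) = (if even m \<and> 0 < m then - \<alpha> else 0)"
proof (induction m)
  case (Suc m)
  show ?case
  proof (cases "m = 0")
    case False
    then have "turn \<alpha> (replicate n 0 @ ys) m = (if even m then \<alpha> else - \<alpha>)"
      using Suc.prems by (simp add: turn_def nth_append)
    with False Suc show ?thesis by (auto simp: sum.atLeastLessThan_Suc)
  qed simp
qed simp

lemma total_turn_fibw_1: "total_turn \<alpha> (fibw i (Suc 0)) = - \<alpha>"
  by (simp add: total_turn_def turn_def)

lemma length_fibw_2: "1 \<le> i \<Longrightarrow> length (fibw i 2) = i"
  by (simp add: numeral_2_eq_2)

lemma total_turn_fibw_2: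
  assumes "1 \<le> i" shows "total_turn \<alpha> (fibw i 2) = (if even i then - \<alpha> else 0)"
proof -
  have "total_turn \<alpha> (fibw i 2) = (\<Sum>m = 1..<Suc i. turn \<alpha> (fibw i 2) m)"
    unfolding total_turn_def by (simp add: length_fibw_2[OF assms] atLeastLessThanSuc_atLeastAtMost)
  also have "\<dots> = (\<Sum>m = 1..<i. turn \<alpha> (fibw i 2) m)"
    using assms by (simp add: turn_def numeral_2_eq_2 nth_append sum.atLeastLessThan_Suc)
  also have "\<dots> = (if even i then - \<alpha> else 0)"
    using sum_turn_replicate[of i "i - 1" \<alpha> "[1]"] assms by (simp add: numeral_2_eq_2)
  finally show ?thesis .
qed

lemma last_vertex_fibw_1: "last_vertex \<alpha> (fibw i (Suc 0)) = \<i>"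
  by (simp add: last_vertex_def vertex_def direction_def)

text \<open>The curve is a zigzag whose segments alternate between \<i> and \<i> cis (- \<alpha>):
  \<open>i div 2\<close> pairs, and one more segment if \<open>i\<close> is odd.\<close>

lemma last_vertex_fibw_2:
  assumes "1 \<le> i"
  shows "last_vertex \<alpha> (fibw i 2) = \<i> * (of_nat (i div 2) * (1 + cis (- \<alpha>)) + of_nat (i mod 2))"
proof -
  have "last_vertex \<alpha> (fibw i 2) = (\<Sum>m = 1..i. cis (direction \<alpha> (fibw i 2) m))"
    by (simp add: last_vertex_def vertex_def length_fibw_2[OF assms])
  also have "\<dots> = (\<Sum>m = 1..i. if even m then \<i> * cis (- \<alpha>) else \<i>)"
  proof (rule sum.cong[OF refl])
    fix m assume "m \<in> {1..i}"
    then show "cis (direction \<alpha> (fibw i 2) m) = (if even m then \<i> * cis (- \<alpha>) else \<i>)"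
      using sum_turn_replicate[of m "i - 1" \<alpha> "[1]"]
      by (simp add: direction_def numeral_2_eq_2 flip: cis_mult) 
  qed
  also have "\<dots> = \<i> * (of_nat (i div 2) * (1 + cis (- \<alpha>)) + of_nat (i mod 2))"
  proof (induction i)
    case (Suc i)
    then show ?case by (cases "even i") (auto simp: algebra_simps mod2_eq_if elim!: evenE oddE)
  qed simp
  finally show ?thesis .
qed

section \<open>The linear recursion of the endpoints\<close>

text \<open>The positive root of X^2 - 2 (1 + cos \<alpha>) X - 1; the other root is its negative
  reciprocal. It is the growth factor over three indices, so a period of six contributes its
  square.\<close>

definition growth :: "real \<Rightarrow> real" where
  "growth \<alpha> = (1 + cos \<alpha>) + sqrt ((1 + cos \<alpha>)\<^sup>2 + 1)"

lemma growth_eq: "(growth \<alpha>)\<^sup>2 = 2 * (1 + cos \<alpha>) * growth \<alpha> + 1"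
proof -
  have "(sqrt ((1 + cos \<alpha>)\<^sup>2 + 1))\<^sup>2 = (1 + cos \<alpha>)\<^sup>2 + 1" by (simp add: add_nonneg_nonneg)
  then show ?thesis unfolding growth_def by (simp add: power2_eq_square algebra_simps)
qed

lemma growth_gt_1:
  assumes "0 \<le> cos \<alpha>" shows "1 < growth \<alpha>"
proof -
  have "0 < sqrt ((1 + cos \<alpha>)\<^sup>2 + 1)" by (intro real_sqrt_gt_zero add_nonneg_pos) auto
  then show ?thesis using assms unfolding growth_def by linarith
qed

text \<open>The real coordinates of the system decouple: writing \<open>\<tau> = tan (\<alpha> / 2)\<close>, the imaginary part
  of \<open>g\<close> alternates in sign and \<open>Im x + \<tau> (Re x + Re g)\<close> is invariant; what remains is a
  two-dimensional system, shifted by multiples of \<open>Im g\<close>, whose eigenvalues are \<open>\<mu>\<close> and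
  \<open>- 1 / \<mu>\<close> for \<open>\<mu> = growth \<alpha>\<close>.\<close>
lemma twisted_recurrence_asymptotics:
  fixes x g :: "nat \<Rightarrow> complex"
  assumes cos: "0 \<le> cos \<alpha>"
    and x: "\<And>k. x (Suc k) = x k + cis (- \<alpha>) * (x k + cnj (x k)) + g k + cis (- \<alpha>) * cnj (g k)"
    and g: "\<And>k. g (Suc k) = cnj (g k) + x k + cnj (x k)"
    and x0: "tan (\<alpha> / 2) * Im (g 0) < Re (x 0)"
    and g0: "0 \<le> Re (g 0) + tan (\<alpha> / 2) * Im (g 0)"
  shows "\<exists>a b B. Re a > 0 \<and> (\<forall>k. norm (x k - a * of_real (growth \<alpha> ^ k)) \<le> B) \<and>
    (\<forall>k. norm (g k - b * of_real (growth \<alpha> ^ k)) \<le> B)"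
proof -
  \<comment> \<open>\<open>\<tau>\<close> is tan (\<alpha> / 2); the identities \<tau> (1 + c) = s
    and \<tau> s = 1 - c are what cancels the cross terms below.\<close>
  define c s \<tau> \<mu> where "c = cos \<alpha>" and "s = sin \<alpha>" and "\<tau> = s / (1 + c)" and "\<mu> = growth \<alpha>"
  have c: "0 \<le> c" and \<mu>: "1 < \<mu>" using cos growth_gt_1[OF cos] by (auto simp: c_def \<mu>_def)
  have tan: "tan (\<alpha> / 2) = \<tau>"
    using tan_half[of "\<alpha> / 2"] by (simp add: \<tau>_def s_def c_def add.commute)
  have \<tau>1: "s = \<tau> * (1 + c)" using c by (simp add: \<tau>_def)
  have "s\<^sup>2 + c\<^sup>2 = 1" by (simp add: s_def c_def)
  then have "s * s = (1 - c) * (1 + c)" by (simp add: power2_eq_square algebra_simps)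
  then have \<tau>2: "\<tau> * s = 1 - c" using c by (simp add: \<tau>_def)
  have \<mu>c: "2 * c = \<mu> - 2 - 1 / \<mu>"
    using growth_eq[of \<alpha>] \<mu> by (simp add: \<mu>_def c_def power2_eq_square field_simps)
  define \<eta> X Y G where "\<eta> k = Im (g k)" and "X k = Re (x k) - \<tau> * Im (g k)"
    and "Y k = Im (x k)" and "G k = Re (g k) + \<tau> * Im (g k)" for k
  have X_Suc: "X (Suc k) = (1 + 2 * c) * X k + (1 + c) * G k" for k
  proof -
    have "X (Suc k) - (1 + 2 * c) * X k - (1 + c) * G k = (\<tau> * (1 + c) - s) * Im (g k)"
      unfolding X_def G_def x g by (simp add: c_def s_def algebra_simps)
    then show ?thesis using \<tau>1 by simp
  qed
  have G_Suc: "G (Suc k) = G k + 2 * X k" for k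
    unfolding X_def G_def g by (simp add: algebra_simps)
  have Y_Suc: "Y (Suc k) + \<tau> * (X (Suc k) + G (Suc k)) = Y k + \<tau> * (X k + G k)" for k
  proof -
    have "Y (Suc k) + \<tau> * (X (Suc k) + G (Suc k)) - (Y k + \<tau> * (X k + G k)) =
        2 * (\<tau> * (1 + c) - s) * Re (x k) + (\<tau> * (1 + c) - s) * Re (g k) + (1 - c - \<tau> * s) * Im (g k)"
      unfolding Y_def X_def G_def x g by (simp add: c_def s_def algebra_simps)
    then show ?thesis using \<tau>1 \<tau>2 by simp
  qed
  \<comment> \<open>Left eigenvectors of the system for \<open>X\<close> and \<open>G\<close>, with
    eigenvalues \<mu> and - 1 / \<mu>; \<open>v\<close> arises from \<open>u\<close> on replacing
    \<mu> by - 1 / \<mu>.\<close>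
  define u v where "u k = 2 * X k + (1 + 1 / \<mu>) * G k" and "v k = 2 * X k - (\<mu> - 1) * G k" for k
  have u: "u k = u 0 * \<mu> ^ k" for k
  proof (induction k)
    case (Suc k)
    have "u (Suc k) = (2 + 2 * (2 * c)) * X k + (2 + 2 * c) * G k + (1 + 1 / \<mu>) * (G k + 2 * X k)"
      unfolding u_def X_Suc G_Suc by (simp add: algebra_simps)
    also have "\<dots> = \<mu> * u k" unfolding \<mu>c u_def using \<mu> by (simp add: field_simps)
    finally show ?case using Suc by simp
  qed simp
  have v: "\<bar>v k\<bar> \<le> \<bar>v 0\<bar>" for k
  proof (induction k)
    case (Suc k)
    have "v (Suc k) = (2 + 2 * (2 * c)) * X k + (2 + 2 * c) * G k - (\<mu> - 1) * (G k + 2 * X k)"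
      unfolding v_def X_Suc G_Suc by (simp add: algebra_simps)
    also have "\<dots> = - (1 / \<mu>) * v k" unfolding \<mu>c v_def using \<mu> by (simp add: field_simps)
    finally have "\<bar>v (Suc k)\<bar> = \<bar>v k\<bar> / \<mu>" using \<mu> by (simp add: abs_mult)
    also have "\<dots> \<le> \<bar>v k\<bar>" using \<mu> by (simp add: divide_le_eq mult_le_cancel_left1)
    finally show ?case using Suc by simp
  qed simp
  have \<eta>: "\<bar>\<eta> k\<bar> = \<bar>\<eta> 0\<bar>" for k
    by (induction k) (simp_all add: \<eta>_def g)
  have Y: "Y k = Y 0 + \<tau> * (X 0 + G 0) - \<tau> * (X k + G k)" for k
  proof (induction k)
    case (Suc k)
    then show ?case using Y_Suc[of k] by simp
  qed simp
  \<comment> \<open>The gap between the two eigenvalues. Since u - v = p G, it is the denominator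
    when solving for \<open>G\<close> and \<open>X\<close>.\<close>
  define p where "p = \<mu> + 1 / \<mu>"
  have p: "0 < p" using \<mu> by (simp add: p_def add_pos_pos)
  define a b where "a = (\<mu> - 1) * u 0 / (2 * p)" and "b = u 0 / p"
  have G_eq: "G k = b * \<mu> ^ k - v k / p" for k
  proof -
    have "p * G k = u k - v k" by (simp add: p_def u_def v_def algebra_simps)
    then show ?thesis using p u[of k] by (simp add: b_def field_simps)
  qed
  have X_eq: "X k = a * \<mu> ^ k + (1 + 1 / \<mu>) * v k / (2 * p)" for k
  proof -
    have "2 * p * X k = (\<mu> - 1) * u k + (1 + 1 / \<mu>) * v k"
      using \<mu> by (simp add: p_def u_def v_def field_simps)
    then have "X k = ((\<mu> - 1) * u k + (1 + 1 / \<mu>) * v k) / (2 * p)"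
      using p by (simp add: eq_divide_eq mult.commute)
    then show ?thesis using u[of k] by (simp add: a_def add_divide_distrib mult.assoc)
  qed
  \<comment> \<open>The assumptions on the initial values say exactly this; they make the component
    along the growing eigenvector positive.\<close>
  have "X 0 > 0" "G 0 \<ge> 0" using x0 g0 by (simp_all add: X_def G_def tan)
  then have "u 0 > 0" unfolding u_def using \<mu> by (intro add_pos_nonneg mult_nonneg_nonneg) auto
  then have "a > 0" using \<mu> p by (simp add: a_def)
  define V where "V = 2 * \<bar>v 0\<bar> / p"
  have dX: "\<bar>X k - a * \<mu> ^ k\<bar> \<le> V" for k
  proof -
    have "\<bar>X k - a * \<mu> ^ k\<bar> = (1 + 1 / \<mu>) * \<bar>v k\<bar> / (2 * p)"
      using \<mu> p by (simp add: X_eq abs_mult)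
    also have "\<dots> \<le> 2 * \<bar>v 0\<bar> / (1 * p)"
      using \<mu> p v[of k] by (intro frac_le mult_mono mult_right_mono) (auto simp: divide_le_eq)
    finally show ?thesis by (simp add: V_def)
  qed
  have dG: "\<bar>G k - b * \<mu> ^ k\<bar> \<le> V" for k
  proof -
    have "\<bar>G k - b * \<mu> ^ k\<bar> = \<bar>v k\<bar> / p" using p by (simp add: G_eq)
    also have "\<dots> \<le> 2 * \<bar>v 0\<bar> / p" using p v[of k] by (intro divide_right_mono) auto
    finally show ?thesis by (simp add: V_def)
  qed
  define \<kappa> where "\<kappa> = Y 0 + \<tau> * (X 0 + G 0)"
  define B where "B = \<bar>\<kappa>\<bar> + (2 + 2 * \<bar>\<tau>\<bar>) * V + (1 + \<bar>\<tau>\<bar>) * \<bar>\<eta> 0\<bar>"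
  have V: "0 \<le> V" using p by (simp add: V_def)
  have \<tau>\<eta>: "\<bar>\<tau> * \<eta> k\<bar> = \<bar>\<tau>\<bar> * \<bar>\<eta> 0\<bar>" for k using \<eta>[of k] by (simp add: abs_mult)
  have nn: "0 \<le> \<bar>\<tau>\<bar> * V" "0 \<le> \<bar>\<tau>\<bar> * \<bar>\<eta> 0\<bar>" using V by simp_all
  \<comment> \<open>The invariant gives Im x = \<kappa> - \<tau> (X + G), hence the imaginary part
    of the first witness. The second is real because \<open>Im (g k)\<close> stays bounded.\<close>
  show ?thesis
  proof (rule exI[of _ "Complex a (- \<tau> * (a + b))"], rule exI[of _ "of_real b"], rule exI[of _ B],
      intro conjI allI)
    show "0 < Re (Complex a (- \<tau> * (a + b)))" using \<open>a > 0\<close> by simp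
    fix k
    have Re: "\<bar>Re (x k) - a * \<mu> ^ k\<bar> \<le> V + \<bar>\<tau>\<bar> * \<bar>\<eta> 0\<bar>"
      using dX[of k] \<tau>\<eta>[of k] unfolding X_def \<eta>_def by linarith
    have Im: "\<bar>Im (x k) + \<tau> * (a + b) * \<mu> ^ k\<bar> \<le> \<bar>\<kappa>\<bar> + \<bar>\<tau>\<bar> * (2 * V)"
    proof -
      have "Im (x k) + \<tau> * (a + b) * \<mu> ^ k = \<kappa> - \<tau> * ((X k - a * \<mu> ^ k) + (G k - b * \<mu> ^ k))"
        using Y[of k] by (simp add: Y_def[of k] \<kappa>_def algebra_simps)
      moreover have "\<bar>\<tau> * ((X k - a * \<mu> ^ k) + (G k - b * \<mu> ^ k))\<bar> \<le> \<bar>\<tau>\<bar> * (2 * V)"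
        unfolding abs_mult using dX[of k] dG[of k] by (intro mult_left_mono) auto
      ultimately show ?thesis by linarith
    qed
    have "norm (x k - Complex a (- \<tau> * (a + b)) * of_real (\<mu> ^ k)) \<le>
        \<bar>Re (x k) - a * \<mu> ^ k\<bar> + \<bar>Im (x k) + \<tau> * (a + b) * \<mu> ^ k\<bar>"
      using cmod_le[of "x k - Complex a (- \<tau> * (a + b)) * of_real (\<mu> ^ k)"]
      by (simp add: algebra_simps)
    also have "\<dots> \<le> (V + \<bar>\<tau>\<bar> * \<bar>\<eta> 0\<bar>) + (\<bar>\<kappa>\<bar> + \<bar>\<tau>\<bar> * (2 * V))" by (rule add_mono[OF Re Im])
    also have "\<dots> \<le> B" using V by (simp add: B_def algebra_simps)
    finally show "norm (x k - Complex a (- \<tau> * (a + b)) * of_real (growth \<alpha> ^ k)) \<le> B"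
      by (simp add: \<mu>_def)
    have Re: "\<bar>Re (g k) - b * \<mu> ^ k\<bar> \<le> V + \<bar>\<tau>\<bar> * \<bar>\<eta> 0\<bar>"
      using dG[of k] \<tau>\<eta>[of k] unfolding G_def \<eta>_def by linarith
    have "norm (g k - of_real b * of_real (\<mu> ^ k)) \<le> \<bar>Re (g k) - b * \<mu> ^ k\<bar> + \<bar>Im (g k)\<bar>"
      using cmod_le[of "g k - of_real b * of_real (\<mu> ^ k)"] by simp
    also have "\<dots> \<le> (V + \<bar>\<tau>\<bar> * \<bar>\<eta> 0\<bar>) + \<bar>\<eta> 0\<bar>"
      using \<eta>[of k] by (intro add_mono Re) (simp add: \<eta>_def)
    also have "\<dots> \<le> B" using V nn by (simp add: B_def algebra_simps)
    finally show "norm (g k - of_real b * of_real (growth \<alpha> ^ k)) \<le> B"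
      by (simp add: \<mu>_def)
  qed
qed

section \<open>Fibonacci curves\<close>

text \<open>From here on indices start at 0, so that the recursion for \<open>fibw\<close> holds at every index. The factor
  \<open>- \<i>\<close> turns the initial direction \<open>\<pi> / 2\<close> to 0, which makes the reflection plain conjugation.\<close>
definition fib_endpoint :: "nat \<Rightarrow> real \<Rightarrow> nat \<Rightarrow> complex" where
  "fib_endpoint i \<alpha> n = - \<i> * last_vertex \<alpha> (fibw i (Suc n))"

text \<open>These two data determine \<open>placement\<close> and satisfy a recursion of their own,
  so the periodicity can be checked on them alone.\<close>

definition fib_heading :: "nat \<Rightarrow> real \<Rightarrow> nat \<Rightarrow> bool \<times> real" where
  "fib_heading i \<alpha> n = (even (length (fibw i (Suc n))), total_turn \<alpha> (fibw i (Suc n)))"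

lemma fib_heading_Suc_Suc:
  "fib_heading i \<alpha> (Suc (Suc n)) =
     (case (fib_heading i \<alpha> (Suc n), fib_heading i \<alpha> n) of
        ((p, s), (q, t)) \<Rightarrow> (p = q, s + (if p then t else - t)))"
  by (simp add: fib_heading_def total_turn_append)

lemma fib_heading_0: "fib_heading i \<alpha> 0 = (False, - \<alpha>)"
  unfolding fib_heading_def total_turn_fibw_1 by simp

lemma fib_heading_1:
  assumes "1 \<le> i" shows "fib_heading i \<alpha> (Suc 0) = (even i, if even i then - \<alpha> else 0)"
  using length_fibw_2[OF assms] total_turn_fibw_2[OF assms]
  by (simp add: fib_heading_def numeral_2_eq_2)

text \<open>By the second-order recursion it is enough that the first two headings recur after six
  steps, a computation for each parity of \<open>i\<close>. The total turns recur as real numbers,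
  not just modulo 2 pi.\<close>

lemma fib_heading_periodic:
  assumes "1 \<le> i" shows "fib_heading i \<alpha> (6 * k + n) = fib_heading i \<alpha> n"
proof -
  have "fib_heading i \<alpha> (n + 6) = fib_heading i \<alpha> n \<and>
      fib_heading i \<alpha> (Suc n + 6) = fib_heading i \<alpha> (Suc n)" for n
  proof (induction n)
    case 0
    then show ?case
      by (cases "even i")
        (simp_all add: eval_nat_numeral fib_heading_Suc_Suc fib_heading_0 fib_heading_1[OF assms])
  next
    case (Suc n)
    then show ?case
      using fib_heading_Suc_Suc[of i \<alpha> "n + 6"] fib_heading_Suc_Suc[of i \<alpha> n] by simp
  qed
  then have "fib_heading i \<alpha> (n + 6) = fib_heading i \<alpha> n" for n by blast
  from this[of "6 * k + n" for k] show ?thesis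
    by (induction k) (simp_all add: add.commute add.left_commute)
qed

lemma fib_endpoint_Suc_Suc:
  "fib_endpoint i \<alpha> (Suc (Suc n)) = fib_endpoint i \<alpha> (Suc n) +
     (case fib_heading i \<alpha> (Suc n) of
        (p, t) \<Rightarrow> cis t * (if p then fib_endpoint i \<alpha> n else cnj (fib_endpoint i \<alpha> n)))"
  by (simp add: fib_endpoint_def fib_heading_def last_vertex_append placement_def algebra_simps)

lemma fib_endpoint_0: "fib_endpoint i \<alpha> 0 = 1"
  unfolding fib_endpoint_def last_vertex_fibw_1 by simp

lemma fib_endpoint_1:
  assumes "1 \<le> i"
  shows "fib_endpoint i \<alpha> (Suc 0) = of_nat (i div 2) * (1 + cis (- \<alpha>)) + of_nat (i mod 2)"
  using last_vertex_fibw_2[OF assms, of \<alpha>]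
  by (simp add: fib_endpoint_def numeral_2_eq_2 flip: mult.assoc)

text \<open>The factor \<i> between \<open>fib_endpoint\<close> and \<open>last_vertex\<close> has
  modulus 1, so it only rotates the coefficients \<open>a\<close> and \<open>b\<close>.\<close>

lemma fib_curve_scaling_limit:
  assumes i: "1 \<le> i" and c: "1 < c" and a: "a \<noteq> 0"
    and asymp: "\<And>k. norm (fib_endpoint i \<alpha> (6 * k + Suc j) - a * of_real (c ^ k)) \<le> B"
      "\<And>k. norm (fib_endpoint i \<alpha> (6 * k + j) - b * of_real (c ^ k)) \<le> B"
  shows "hausdorff_converges (\<lambda>k. dilate (sqrt 2 / fib_width i \<alpha> (Suc (6 * k + Suc j)))
    (fib_curve i \<alpha> (Suc (6 * k + Suc j))))"
proof -
  let ?f = "\<lambda>n. fibw i (Suc n)"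
  have eq: "last_vertex \<alpha> (?f n) = \<i> * fib_endpoint i \<alpha> n" for n
    by (simp add: fib_endpoint_def)
  have norm_eq: "norm (last_vertex \<alpha> (?f n) - \<i> * w * z) = norm (fib_endpoint i \<alpha> n - w * z)" for n w z
  proof -
    have "last_vertex \<alpha> (?f n) - \<i> * w * z = \<i> * (fib_endpoint i \<alpha> n - w * z)"
      by (simp add: eq algebra_simps)
    then show ?thesis by (simp add: norm_mult)
  qed
  have nonempty: "?f n \<noteq> []" for n by (induction n rule: fibw.induct[of _ i]) auto
  have "hausdorff_converges (\<lambda>k. dilate (sqrt 2 / norm (last_vertex \<alpha> (?f (6 * k + Suc j))))
      (curve \<alpha> (?f (6 * k + Suc j))))"
  proof (rule scaling_limit_of_self_similar_curves[where U = "\<lambda>n. placement \<alpha> (?f n)"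
        and a = "\<i> * a" and b = "\<i> * b" and B = B])
    show "placement \<alpha> (?f (n + 6)) = placement \<alpha> (?f n)" for n
      using fib_heading_periodic[OF i, of \<alpha> 1 n]
      by (simp add: fib_heading_def placement_def fun_eq_iff add.commute)
    show "norm (last_vertex \<alpha> (?f (6 * k + Suc j)) - \<i> * a * of_real (c ^ k)) \<le> B" for k
      unfolding norm_eq by (rule asymp)
    show "norm (last_vertex \<alpha> (?f (6 * k + j)) - \<i> * b * of_real (c ^ k)) \<le> B" for k
      unfolding norm_eq by (rule asymp)
  qed (use a c nonempty in \<open>auto simp: curve_append last_vertex_append linear_placement
      norm_placement bounded_curve curve_nonempty\<close>)
  then show ?thesis
    by (simp add: fib_width_def fib_curve_def last_vertex_def vertex_def)
qed

section \<open>The two parities of i\<close>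

lemma fib_scaling_limit_even:
  assumes i: "2 \<le> i" "even i" and \<alpha>: "0 < \<alpha>" "\<alpha> \<le> pi / 2"
  shows "hausdorff_converges (\<lambda>k. dilate (sqrt 2 / fib_width i \<alpha> (6 * k + 5)) (fib_curve i \<alpha> (6 * k + 5)))"
proof -
  define d w v \<mu> where "d = fib_endpoint i \<alpha>" and "w = cis \<alpha>" and "v = cis (- \<alpha>)" and "\<mu> = growth \<alpha>"
  have i1: "1 \<le> i" using i by simp
  have cos: "0 \<le> cos \<alpha>" using \<alpha> by (intro cos_ge_zero) auto
  have cnj: "cnj w = v" "cnj v = w" by (simp_all add: w_def v_def cis_cnj)
  have inv: "w * (v * z) = z" "v * (w * z) = z" for z
    by (simp_all add: w_def v_def cis_mult flip: mult.assoc)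
  have heading: "fib_heading i \<alpha> (6 * m + 0) = (False, - \<alpha>)" "fib_heading i \<alpha> (6 * m + 1) = (True, - \<alpha>)"
    "fib_heading i \<alpha> (6 * m + 2) = (False, - 2 * \<alpha>)" "fib_heading i \<alpha> (6 * m + 3) = (False, - \<alpha>)"
    "fib_heading i \<alpha> (6 * m + 4) = (True, \<alpha>)" "fib_heading i \<alpha> (6 * m + 5) = (False, 0)" for m
    unfolding fib_heading_periodic[OF i1]
    using i by (simp_all add: eval_nat_numeral fib_heading_Suc_Suc fib_heading_0 fib_heading_1[OF i1])
  have v2: "cis (- (2 * \<alpha>)) = v * v" by (simp add: v_def cis_mult)
  have d: "d (6 * m + 2) = d (6 * m + 1) + v * d (6 * m)"
    "d (6 * m + 3) = d (6 * m + 2) + v * v * cnj (d (6 * m + 1))"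
    "d (6 * m + 4) = d (6 * m + 3) + v * cnj (d (6 * m + 2))"
    "d (6 * m + 5) = d (6 * m + 4) + w * d (6 * m + 3)"
    "d (6 * m + 6) = d (6 * m + 5) + cnj (d (6 * m + 4))"
    "d (6 * m + 7) = d (6 * m + 6) + v * cnj (d (6 * m + 5))" for m
    using fib_endpoint_Suc_Suc[of i \<alpha> "6 * m"] fib_endpoint_Suc_Suc[of i \<alpha> "6 * m + 1"]
      fib_endpoint_Suc_Suc[of i \<alpha> "6 * m + 2"] fib_endpoint_Suc_Suc[of i \<alpha> "6 * m + 3"]
      fib_endpoint_Suc_Suc[of i \<alpha> "6 * m + 4"] fib_endpoint_Suc_Suc[of i \<alpha> "6 * m + 5"]
      heading[of m] heading(1)[of "Suc m"]
    by (simp_all add: d_def v2 eval_nat_numeral flip: v_def w_def)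
  \<comment> \<open>Both halves of a period show the same length parities but different turns.
    Rotation by \<open>w\<close> and conjugation, chosen by the parity of \<open>k\<close>, bring
    both to the recurrence of \<open>twisted_recurrence_asymptotics\<close>.\<close>
  define x g where "x k = (if even k then cnj (w * d (3 * k + 1)) else d (3 * k + 1))"
    and "g k = (if even k then cnj (d (3 * k)) else w * d (3 * k))" for k
  have rec: "x (Suc k) = x k + v * (x k + cnj (x k)) + g k + v * cnj (g k) \<and>
      g (Suc k) = cnj (g k) + x k + cnj (x k)" for k
  proof (cases "even k")
    case True
    then obtain m where k: "k = 2 * m" by blast
    have eqs: "3 * k = 6 * m" "3 * k + 1 = 6 * m + 1" "3 * Suc k = 6 * m + 3" "3 * Suc k + 1 = 6 * m + 4"
      by (simp_all add: k)
    show ?thesis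
      using True unfolding x_def g_def eqs(2,4) unfolding eqs(1,3) d by (simp add: cnj inv algebra_simps)
  next
    case False
    then obtain m where k: "k = 2 * m + 1" by (rule oddE)
    have eqs: "3 * k = 6 * m + 3" "3 * k + 1 = 6 * m + 4" "3 * Suc k = 6 * m + 6" "3 * Suc k + 1 = 6 * m + 7"
      by (simp_all add: k)
    show ?thesis
      using False unfolding x_def g_def eqs(2,4) unfolding eqs(1,3) d(4,5,6) by (simp add: cnj inv algebra_simps)
  qed
  have d1: "d 1 = of_nat (i div 2) * (1 + v)"
    using fib_endpoint_1[OF i1, of \<alpha>] i by (simp add: d_def v_def)
  have x0: "x 0 = of_nat (i div 2) * (1 + v)"
  proof -
    have "x 0 = of_nat (i div 2) * (v + v * w)"
      by (simp add: x_def d1[unfolded One_nat_def] cnj algebra_simps)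
    then show ?thesis using inv(2)[of 1] by (simp add: add.commute)
  qed
  have g0: "g 0 = 1" by (simp add: g_def d_def fib_endpoint_0)
  have "0 < Re (x 0)"
    unfolding x0 v_def using i cos by (simp add: add_pos_nonneg div_greater_zero_iff)
  then have x_pos: "tan (\<alpha> / 2) * Im (g 0) < Re (x 0)"
    and g_pos: "0 \<le> Re (g 0) + tan (\<alpha> / 2) * Im (g 0)"
    by (simp_all add: g0)
  obtain a b B where ab: "Re a > 0"
    "\<And>k. norm (x k - a * of_real (growth \<alpha> ^ k)) \<le> B"
    "\<And>k. norm (g k - b * of_real (growth \<alpha> ^ k)) \<le> B"
    using twisted_recurrence_asymptotics[OF cos, of x g, folded v_def,
        OF rec[THEN conjunct1] rec[THEN conjunct2] x_pos g_pos]
    by blast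
  have \<mu>: "1 < \<mu>" using growth_gt_1[OF cos] by (simp add: \<mu>_def)
  \<comment> \<open>Word 6k + 5 has 0-based index 6k + 4 = 3 (2k + 1) + 1, so \<open>x\<close> and
    \<open>g\<close> are taken at 2k + 1; the odd exponent leaves one extra factor \<mu> in both
    coefficients.\<close>
  have "hausdorff_converges (\<lambda>k. dilate (sqrt 2 / fib_width i \<alpha> (Suc (6 * k + Suc 3)))
      (fib_curve i \<alpha> (Suc (6 * k + Suc 3))))"
  proof (rule fib_curve_scaling_limit[where a = "a * of_real \<mu>" and b = "v * (b * of_real \<mu>)"])
    show "1 < \<mu>\<^sup>2" using \<mu> by (simp add: one_less_power)
    show "a * of_real \<mu> \<noteq> 0" using ab(1) \<mu> by auto
    fix k
    have pow: "growth \<alpha> ^ (2 * k + 1) = \<mu> * (\<mu>\<^sup>2) ^ k" by (simp add: \<mu>_def power_mult)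
    have "x (2 * k + 1) = d (6 * k + Suc 3)" by (simp add: x_def add.commute)
    then show "norm (fib_endpoint i \<alpha> (6 * k + Suc 3) - a * of_real \<mu> * of_real ((\<mu>\<^sup>2) ^ k)) \<le> B"
      using ab(2)[of "2 * k + 1"] unfolding pow by (simp add: d_def mult.assoc)
    have "d (6 * k + 3) - v * (b * of_real \<mu>) * of_real ((\<mu>\<^sup>2) ^ k) =
        v * (g (2 * k + 1) - b * of_real (\<mu> * (\<mu>\<^sup>2) ^ k))"
      by (simp add: g_def inv algebra_simps)
    then show "norm (fib_endpoint i \<alpha> (6 * k + 3) - v * (b * of_real \<mu>) * of_real ((\<mu>\<^sup>2) ^ k)) \<le> B"
      using ab(3)[of "2 * k + 1"] unfolding pow by (simp add: d_def norm_mult v_def)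
  qed (use i1 in simp)
  then show ?thesis by (simp add: eval_nat_numeral)
qed

lemma fib_scaling_limit_odd:
  assumes i: "2 \<le> i" "odd i" and \<alpha>: "0 < \<alpha>" "\<alpha> \<le> pi / 2"
  shows "hausdorff_converges (\<lambda>k. dilate (sqrt 2 / fib_width i \<alpha> (6 * k + 3)) (fib_curve i \<alpha> (6 * k + 3)))"
proof -
  \<comment> \<open>Half angles, unlike the even case: the twist is shared between \<open>x\<close>
    and \<open>g\<close>, and \<open>v * v\<close> is the cis (- \<alpha>) of the
    recurrence.\<close>
  define d w v \<mu> where "d = fib_endpoint i \<alpha>" and "w = cis (\<alpha> / 2)" and "v = cis (- \<alpha> / 2)"
    and "\<mu> = growth \<alpha>"
  have i1: "1 \<le> i" using i by simp
  have cos: "0 \<le> cos \<alpha>" using \<alpha> by (intro cos_ge_zero) auto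
  have cnj: "cnj w = v" "cnj v = w" by (simp_all add: w_def v_def cis_cnj)
  have inv: "w * (v * z) = z" "v * (w * z) = z" for z
    by (simp_all add: w_def v_def cis_mult flip: mult.assoc)
  have heading: "fib_heading i \<alpha> (6 * m + 0) = (False, - \<alpha>)" "fib_heading i \<alpha> (6 * m + 1) = (False, 0)"
    "fib_heading i \<alpha> (6 * m + 2) = (True, \<alpha>)" "fib_heading i \<alpha> (6 * m + 3) = (False, \<alpha>)"
    "fib_heading i \<alpha> (6 * m + 4) = (False, 0)" "fib_heading i \<alpha> (6 * m + 5) = (True, - \<alpha>)" for m
    unfolding fib_heading_periodic[OF i1]
    using i by (simp_all add: eval_nat_numeral fib_heading_Suc_Suc fib_heading_0 fib_heading_1[OF i1])
  have w2: "cis \<alpha> = w * w" and v2: "cis (- \<alpha>) = v * v" by (simp_all add: w_def v_def cis_mult)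
  have d: "d (6 * m + 2) = d (6 * m + 1) + cnj (d (6 * m))"
    "d (6 * m + 3) = d (6 * m + 2) + w * w * d (6 * m + 1)"
    "d (6 * m + 4) = d (6 * m + 3) + w * w * cnj (d (6 * m + 2))"
    "d (6 * m + 5) = d (6 * m + 4) + cnj (d (6 * m + 3))"
    "d (6 * m + 6) = d (6 * m + 5) + v * v * d (6 * m + 4)"
    "d (6 * m + 7) = d (6 * m + 6) + v * v * cnj (d (6 * m + 5))"
    "d (6 * m + 8) = d (6 * m + 7) + cnj (d (6 * m + 6))" for m
    using fib_endpoint_Suc_Suc[of i \<alpha> "6 * m"] fib_endpoint_Suc_Suc[of i \<alpha> "6 * m + 1"]
      fib_endpoint_Suc_Suc[of i \<alpha> "6 * m + 2"] fib_endpoint_Suc_Suc[of i \<alpha> "6 * m + 3"]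
      fib_endpoint_Suc_Suc[of i \<alpha> "6 * m + 4"] fib_endpoint_Suc_Suc[of i \<alpha> "6 * m + 5"]
      fib_endpoint_Suc_Suc[of i \<alpha> "6 * m + 6"]
      heading[of m] heading(1,2)[of "Suc m"]
    by (simp_all add: d_def v2 w2 eval_nat_numeral)
  define x g where "x k = v * (if even k then d (3 * k + 2) else cnj (d (3 * k + 2)))"
    and "g k = w * (if even k then d (3 * k + 1) else cnj (d (3 * k + 1)))" for k
  have rec: "x (Suc k) = x k + v * v * (x k + cnj (x k)) + g k + v * v * cnj (g k) \<and>
      g (Suc k) = cnj (g k) + x k + cnj (x k)" for k
  proof (cases "even k")
    case True
    then obtain m where k: "k = 2 * m" by blast
    have eqs: "3 * k + 1 = 6 * m + 1" "3 * k + 2 = 6 * m + 2"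
      "3 * Suc k + 1 = 6 * m + 4" "3 * Suc k + 2 = 6 * m + 5"
      by (simp_all add: k)
    show ?thesis
      using True unfolding x_def g_def eqs d(4,3) d(2) by (simp add: cnj inv algebra_simps)
  next
    case False
    then obtain m where k: "k = 2 * m + 1" by (rule oddE)
    have eqs: "3 * k + 1 = 6 * m + 4" "3 * k + 2 = 6 * m + 5"
      "3 * Suc k + 1 = 6 * m + 7" "3 * Suc k + 2 = 6 * m + 8"
      by (simp_all add: k)
    show ?thesis
      using False unfolding x_def g_def eqs d(7,6) d(5) by (simp add: cnj inv algebra_simps)
  qed
  define n C S where "n = i div 2" and "C = cos (\<alpha> / 2)" and "S = sin (\<alpha> / 2)"
  have d1: "d 1 = of_nat n * (1 + v * v) + 1"
    using fib_endpoint_1[OF i1, of \<alpha>] i by (simp add: d_def v2 n_def odd_iff_mod_2_eq_one)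
  have d0: "d 0 = 1" by (simp add: d_def fib_endpoint_0)
  have d2: "d 2 = of_nat n * (1 + v * v) + 2"
    using d(1)[of 0] d1 by (simp add: d0 numeral_2_eq_2)
  have wv: "w + v = of_real (2 * C)"
    by (simp add: w_def v_def C_def complex_eq_iff)
  have g0: "g 0 = of_nat n * (w + v) + w" by (simp add: g_def d1[unfolded One_nat_def] inv algebra_simps)
  have x0: "x 0 = of_nat n * (v * v * (w + v)) + 2 * v" by (simp add: x_def d2[unfolded numeral_2_eq_2] inv algebra_simps)
  have Im_g0: "Im (g 0) = S" and Re_g0: "Re (g 0) = (2 * real n + 1) * C"
    unfolding g0 wv by (simp_all add: w_def C_def S_def algebra_simps)
  have Re_x0: "Re (x 0) = 2 * real n * cos \<alpha> * C + 2 * C"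
    unfolding x0 wv v2[symmetric] by (simp add: v_def C_def)
  have "0 < C" unfolding C_def using \<alpha> by (intro cos_gt_zero_pi) auto
  have "0 \<le> S" unfolding S_def using \<alpha> by (intro sin_ge_zero) auto
  have "C\<^sup>2 - S\<^sup>2 = cos \<alpha>" using cos_double[of "\<alpha> / 2"] by (simp add: C_def S_def)
  then have "S\<^sup>2 \<le> C\<^sup>2" using cos by simp
  have tan: "tan (\<alpha> / 2) = S / C" by (simp add: tan_def S_def C_def)
  \<comment> \<open>Here \<open>g 0\<close> is not real. The bound S^2 / C \<le> C uses cos \<alpha>
    \<ge> 0, that is, \<alpha> \<le> pi / 2.\<close>
  have x_pos: "tan (\<alpha> / 2) * Im (g 0) < Re (x 0)"
  proof -
    have "tan (\<alpha> / 2) * Im (g 0) = S\<^sup>2 / C" by (simp add: tan Im_g0 power2_eq_square)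
    also have "\<dots> \<le> C" using \<open>S\<^sup>2 \<le> C\<^sup>2\<close> \<open>0 < C\<close> by (simp add: divide_le_eq power2_eq_square)
    also have "C < 2 * real n * cos \<alpha> * C + 2 * C" using \<open>0 < C\<close> cos by (simp add: add_pos_nonneg)
    finally show ?thesis by (simp add: Re_x0)
  qed
  have g_pos: "0 \<le> Re (g 0) + tan (\<alpha> / 2) * Im (g 0)"
    using \<open>0 < C\<close> \<open>0 \<le> S\<close> by (simp add: tan Im_g0 Re_g0)
  obtain a b B where ab: "Re a > 0"
    "\<And>k. norm (x k - a * of_real (growth \<alpha> ^ k)) \<le> B"
    "\<And>k. norm (g k - b * of_real (growth \<alpha> ^ k)) \<le> B"
    using twisted_recurrence_asymptotics[OF cos, of x g, unfolded v2,
        OF rec[THEN conjunct1] rec[THEN conjunct2] x_pos g_pos]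
    by blast
  have \<mu>: "1 < \<mu>" using growth_gt_1[OF cos] by (simp add: \<mu>_def)
  \<comment> \<open>Word 6k + 3 has 0-based index 6k + 2 = 3 (2k) + 2, so \<open>x\<close> and
    \<open>g\<close> are taken at 2k and no extra factor \<mu> appears.\<close>
  have "hausdorff_converges (\<lambda>k. dilate (sqrt 2 / fib_width i \<alpha> (Suc (6 * k + Suc 1)))
      (fib_curve i \<alpha> (Suc (6 * k + Suc 1))))"
  proof (rule fib_curve_scaling_limit[where a = "w * a" and b = "v * b"])
    show "1 < \<mu>\<^sup>2" using \<mu> by (simp add: one_less_power)
    show "w * a \<noteq> 0" using ab(1) by (auto simp: w_def)
    fix k
    have pow: "growth \<alpha> ^ (2 * k) = (\<mu>\<^sup>2) ^ k" by (simp add: \<mu>_def power_mult)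
    have "d (6 * k + Suc 1) - w * a * of_real ((\<mu>\<^sup>2) ^ k) = w * (x (2 * k) - a * of_real ((\<mu>\<^sup>2) ^ k))"
      by (simp add: x_def inv algebra_simps)
    then show "norm (fib_endpoint i \<alpha> (6 * k + Suc 1) - w * a * of_real ((\<mu>\<^sup>2) ^ k)) \<le> B"
      using ab(2)[of "2 * k"] unfolding pow by (simp add: d_def norm_mult w_def)
    have "d (6 * k + 1) - v * b * of_real ((\<mu>\<^sup>2) ^ k) = v * (g (2 * k) - b * of_real ((\<mu>\<^sup>2) ^ k))"
      by (simp add: g_def inv algebra_simps)
    then show "norm (fib_endpoint i \<alpha> (6 * k + 1) - v * b * of_real ((\<mu>\<^sup>2) ^ k)) \<le> B"
      using ab(3)[of "2 * k"] unfolding pow by (simp add: d_def norm_mult v_def)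
  qed (use i1 in simp)
  then show ?thesis by (simp add: eval_nat_numeral)
qed

theorem theorem5p5:
  fixes i :: nat and \<alpha> :: real
  assumes "i \<ge> 2" and "0 < \<alpha>" and "\<alpha> \<le> pi / 2"
  shows "(even i \<longrightarrow> hausdorff_converges
            (\<lambda>k. dilate (sqrt 2 / fib_width i \<alpha> (6 * k + 5)) (fib_curve i \<alpha> (6 * k + 5))))
       \<and> (odd i \<longrightarrow> hausdorff_converges
            (\<lambda>k. dilate (sqrt 2 / fib_width i \<alpha> (6 * k + 3)) (fib_curve i \<alpha> (6 * k + 3))))"
  using fib_scaling_limit_even[of i \<alpha>] fib_scaling_limit_odd[of i \<alpha>] assms by blast

end
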